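(* Let $p>3$ be a prime and let $f(x)\in\mathbb{Z}_p[x]$ be a polynomial whose leading coefficient is a unit in $\mathbb{Z}_p$. Suppose that $x_1\in\mathbb{Z}_p$ satisfies $$|f(x_1)|_p<|f'(x_1)|_p^2$$ (in particular, $f'(x_1)\neq 0$ and $|f(x_1)|_p<1$, and thus $f(x_1)\equiv 0 \bmod p$). Then the sequence $(x_n)$ defined iteratively by $$x_{n+1}=x_n-\frac{1}{2}\frac{f(x_n)}{f'(x_n)}+\frac{3f(x_n)f'(x_n)^2}{-6f'(x_n)^3+6f(x_n)f'(x_n)f''(x_n)-2f(x_n)^2f'''(x_n)}\qquad (n\ge 1)$$ converges to a simple root $\gamma\in\mathbb{Z}_p$ of $f$ with order of convergence $4$.
   Context: $\mathbb{Z}_p$ denotes the ring of $p$-adic integers and $|\cdot|_p$ the $p$-adic absolute value on $\mathbb{Q}_p$. Order of convergence: a sequence $(x_n)$ in a complete normed space with norm $|\cdot|$ (here $\mathbb{Q}_p$ with $|\cdot|_p$) that converges to $\gamma$ is said to converge with order $q$ if $R_n=\frac{|x_{n+1}-\gamma|}{|x_n-\gamma|^q}$ is a bounded sequence in $\mathbb{R}$. *)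

theory Defs
  imports "HOL-Analysis.Analysis" "HOL-Computational_Algebra.Computational_Algebra"
    Berlekamp_Zassenhaus.Finite_Field
begin

section \<open>The \<open>p\<close>-adic absolute value on the rationals\<close>

text \<open>\<open>|a / b|\<^sub>p = p\<^bsup>v(b) - v(a)\<^esup>\<close>, where \<open>v\<close> is the exponent of \<open>p\<close>; so \<open>|p|\<^sub>p = 1 / p\<close>.\<close>

definition padic_abs :: "nat \<Rightarrow> rat \<Rightarrow> real" where
  "padic_abs p r =
     (if r = 0 then 0
      else real p powi (int (multiplicity (int p) (snd (quotient_of r)))
                        - int (multiplicity (int p) (fst (quotient_of r)))))"

lemma padic_abs_of_int_divide:
  assumes p: "prime p" and "a \<noteq> 0" "b \<noteq> 0"
  shows "padic_abs p (of_int a / of_int b) =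
    real p powi (int (multiplicity (int p) b) - int (multiplicity (int p) a))"
proof -
  define c d where "c = fst (quotient_of (of_int a / of_int b))"
    and "d = snd (quotient_of (of_int a / of_int b))"
  have q: "quotient_of (of_int a / of_int b) = (c, d)"
    by (simp add: c_def d_def)
  have d: "d > 0"
    using quotient_of_denom_pos[OF q] .
  have "(of_int a / of_int b :: rat) = of_int c / of_int d"
    using quotient_of_div[OF q] .
  hence "(of_int (a * d) :: rat) = of_int (c * b)"
    using d \<open>b \<noteq> 0\<close> by (simp add: field_simps)
  hence eq: "a * d = c * b"
    by (simp only: of_int_eq_iff)
  hence c: "c \<noteq> 0"
    using d assms by auto
  have "prime_elem (int p)"
    using p by simp
  hence "multiplicity (int p) a + multiplicity (int p) d =
         multiplicity (int p) c + multiplicity (int p) b"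
    using eq c d assms by (metis less_irrefl prime_elem_multiplicity_mult_distrib)
  thus ?thesis
    using assms by (simp add: padic_abs_def c_def[symmetric] d_def[symmetric]) (smt (verit) of_nat_add)
qed

lemma rat_eq_of_int_divide:
  obtains a b where "(r :: rat) = of_int a / of_int b" "b \<noteq> 0"
proof -
  obtain a b where q: "quotient_of r = (a, b)"
    by (cases "quotient_of r")
  show ?thesis
    using that[of a b] quotient_of_div[OF q] quotient_of_denom_pos[OF q] by auto
qed

lemma padic_abs_0 [simp]: "padic_abs p 0 = 0"
  by (simp add: padic_abs_def)

context
  fixes p :: nat
  assumes p: "prime p"
begin

lemma padic_abs_pos: "r \<noteq> 0 \<Longrightarrow> padic_abs p r > 0"
  using prime_gt_0_nat[OF p] by (simp add: padic_abs_def)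

lemma padic_abs_nonneg: "padic_abs p r \<ge> 0"
  using padic_abs_pos[of r] by (cases "r = 0") auto

lemma padic_abs_eq_0_iff: "padic_abs p r = 0 \<longleftrightarrow> r = 0"
  using padic_abs_pos[of r] by (cases "r = 0") auto

lemma padic_abs_1: "padic_abs p 1 = 1"
  using padic_abs_of_int_divide[OF p, of 1 1] by simp

lemma padic_abs_mult: "padic_abs p (r * s) = padic_abs p r * padic_abs p s"
proof (cases "r = 0 \<or> s = 0")
  case False
  obtain a b where r: "r = of_int a / of_int b" "b \<noteq> 0" by (rule rat_eq_of_int_divide)
  obtain c d where s: "s = of_int c / of_int d" "d \<noteq> 0" by (rule rat_eq_of_int_divide)
  have nz: "a \<noteq> 0" "c \<noteq> 0" using False r s by auto
  have rs: "r * s = of_int (a * c) / of_int (b * d)" by (simp add: r s)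
  have "prime_elem (int p)" using p by simp
  hence v: "multiplicity (int p) (a * c) = multiplicity (int p) a + multiplicity (int p) c"
       "multiplicity (int p) (b * d) = multiplicity (int p) b + multiplicity (int p) d"
    using nz r s by (auto simp: prime_elem_multiplicity_mult_distrib)
  have "padic_abs p (r * s) =
    real p powi (int (multiplicity (int p) (b * d)) - int (multiplicity (int p) (a * c)))"
    unfolding rs using nz r s by (subst padic_abs_of_int_divide[OF p]) auto
  also have "\<dots> = real p powi ((int (multiplicity (int p) b) - int (multiplicity (int p) a)) +
      (int (multiplicity (int p) d) - int (multiplicity (int p) c)))"
    unfolding v by (rule arg_cong[of _ _ "\<lambda>k. real p powi k"]) simp
  also have "\<dots> = padic_abs p r * padic_abs p s"
    using prime_gt_0_nat[OF p] nz r(2) s(2) unfolding r(1) s(1)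
    by (simp add: padic_abs_of_int_divide[OF p] power_int_add)
  finally show ?thesis .
qed auto

lemma padic_abs_minus: "padic_abs p (- r) = padic_abs p r"
proof (cases "r = 0")
  case False
  obtain a b where r: "r = of_int a / of_int b" "b \<noteq> 0" by (rule rat_eq_of_int_divide)
  have "a \<noteq> 0" using False r by auto
  have m: "- r = of_int (- a) / of_int b" using r by simp
  show ?thesis
    unfolding m unfolding r(1) using \<open>a \<noteq> 0\<close> \<open>b \<noteq> 0\<close>
    by (subst (1 2) padic_abs_of_int_divide[OF p]) auto
qed auto

lemma padic_abs_minus_commute: "padic_abs p (r - s) = padic_abs p (s - r)"
  using padic_abs_minus[of "r - s"] by simp

lemma padic_abs_inverse: "padic_abs p (inverse r) = inverse (padic_abs p r)"
proof (cases "r = 0")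
  case False
  hence "padic_abs p r * padic_abs p (inverse r) = 1"
    by (simp add: padic_abs_mult[symmetric] padic_abs_1)
  thus ?thesis by (metis inverse_unique)
qed auto

lemma padic_abs_ultrametric: "padic_abs p (r + s) \<le> max (padic_abs p r) (padic_abs p s)"
proof (cases "r = 0 \<or> s = 0 \<or> r + s = 0")
  case True
  thus ?thesis
    using padic_abs_nonneg[of r] padic_abs_nonneg[of s] by auto
next
  case False
  obtain a b where r: "r = of_int a / of_int b" "b \<noteq> 0" by (rule rat_eq_of_int_divide)
  obtain c d where s: "s = of_int c / of_int d" "d \<noteq> 0" by (rule rat_eq_of_int_divide)
  define e f k where "e = a * d" and "f = c * b" and "k = b * d"
  have k: "k \<noteq> 0" using r s by (simp add: k_def)
  have r': "r = of_int e / of_int k" and s': "s = of_int f / of_int k"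
    using r s by (auto simp: e_def f_def k_def field_simps)
  have rs': "r + s = of_int (e + f) / of_int k"
    by (simp add: r' s' add_divide_distrib)
  have nz: "e \<noteq> 0" "f \<noteq> 0" using False r' s' by auto
  have nz': "e + f \<noteq> 0"
  proof
    assume "e + f = 0"
    thus False using False by (simp add: rs')
  qed
  let ?v = "multiplicity (int p)"
  define m where "m = min (?v e) (?v f)"
  have "int p ^ m dvd e" "int p ^ m dvd f"
    by (auto simp: m_def intro: multiplicity_dvd')
  hence "int p ^ m dvd e + f" by (rule dvd_add)
  moreover have "\<not> is_unit (int p)" using p by auto
  ultimately have "m \<le> ?v (e + f)"
    using nz' by (intro multiplicity_geI) auto
  hence le: "int (?v k) - int (?v (e + f)) \<le> int (?v k) - int m" by simp
  have "padic_abs p (r + s) = real p powi (int (?v k) - int (?v (e + f)))"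
    unfolding rs' by (rule padic_abs_of_int_divide[OF p nz' k])
  also have "\<dots> \<le> real p powi (int (?v k) - int m)"
    using le prime_ge_1_nat[OF p] by (intro power_int_increasing) auto
  also have "\<dots> \<le> max (padic_abs p r) (padic_abs p s)"
    unfolding r' s' padic_abs_of_int_divide[OF p nz(1) k] padic_abs_of_int_divide[OF p nz(2) k]
    by (cases "?v e \<le> ?v f") (simp_all add: m_def)
  finally show ?thesis .
qed

lemma padic_abs_triangle: "padic_abs p (r + s) \<le> padic_abs p r + padic_abs p s"
  using padic_abs_ultrametric[of r s] padic_abs_nonneg[of r] padic_abs_nonneg[of s] by linarith

lemma padic_abs_diff_abs: "\<bar>padic_abs p r - padic_abs p s\<bar> \<le> padic_abs p (r - s)"
  using padic_abs_triangle[of "r - s" s] padic_abs_triangle[of "s - r" r]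
    padic_abs_minus_commute[of r s] by auto

end


section \<open>Cauchy sequences and null sequences of rationals\<close>

definition padic_null :: "nat \<Rightarrow> (nat \<Rightarrow> rat) \<Rightarrow> bool" where
  "padic_null p X \<longleftrightarrow> (\<lambda>n. padic_abs p (X n)) \<longlonglongrightarrow> 0"

definition padic_cauchy :: "nat \<Rightarrow> (nat \<Rightarrow> rat) \<Rightarrow> bool" where
  "padic_cauchy p X \<longleftrightarrow> (\<forall>e>0. \<exists>N. \<forall>m\<ge>N. \<forall>n\<ge>N. padic_abs p (X m - X n) < e)"

definition padic_rel :: "nat \<Rightarrow> (nat \<Rightarrow> rat) \<Rightarrow> (nat \<Rightarrow> rat) \<Rightarrow> bool" where
  "padic_rel p X Y \<longleftrightarrow> padic_cauchy p X \<and> padic_cauchy p Y \<and> padic_null p (\<lambda>n. X n - Y n)"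

lemma padic_cauchy_const [simp]: "padic_cauchy p (\<lambda>_. c)"
  by (simp add: padic_cauchy_def)

lemma padic_null_zero [simp]: "padic_null p (\<lambda>_. 0)"
  by (simp add: padic_null_def)

context
  fixes p :: nat
  assumes p: "prime p"
begin

lemma padic_null_const_iff: "padic_null p (\<lambda>_. c) \<longleftrightarrow> c = 0"
  by (simp add: padic_null_def LIMSEQ_const_iff padic_abs_eq_0_iff[OF p])

lemma padic_null_le:
  assumes "g \<longlonglongrightarrow> 0" "\<forall>\<^sub>F n in sequentially. padic_abs p (X n) \<le> g n"
  shows "padic_null p X"
  unfolding padic_null_def
  by (rule tendsto_sandwich[OF _ assms(2) tendsto_const assms(1)]) (simp add: padic_abs_nonneg[OF p])

lemma padic_null_add: "padic_null p X \<Longrightarrow> padic_null p Y \<Longrightarrow> padic_null p (\<lambda>n. X n + Y n)"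
  by (rule padic_null_le[of "\<lambda>n. padic_abs p (X n) + padic_abs p (Y n)"])
     (auto simp: padic_null_def padic_abs_triangle[OF p] intro: tendsto_add_zero)

lemma padic_null_minus: "padic_null p X \<Longrightarrow> padic_null p (\<lambda>n. - X n)"
  by (simp add: padic_null_def padic_abs_minus[OF p])

lemma padic_null_diff_commute: "padic_null p (\<lambda>n. X n - Y n) \<longleftrightarrow> padic_null p (\<lambda>n. Y n - X n)"
  by (simp add: padic_null_def padic_abs_minus_commute[OF p, of "X _"])

lemma padic_cauchy_convergent:
  assumes "padic_cauchy p X"
  shows "convergent (\<lambda>n. padic_abs p (X n))"
proof (intro Cauchy_convergent metric_CauchyI)
  fix e :: real assume "e > 0"
  then obtain N where "\<forall>m\<ge>N. \<forall>n\<ge>N. padic_abs p (X m - X n) < e"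
    using assms by (auto simp: padic_cauchy_def)
  thus "\<exists>N. \<forall>m\<ge>N. \<forall>n\<ge>N. dist (padic_abs p (X m)) (padic_abs p (X n)) < e"
    unfolding dist_real_def using le_less_trans[OF padic_abs_diff_abs[OF p]] by blast
qed

lemma padic_cauchy_tendsto:
  "padic_cauchy p X \<Longrightarrow> (\<lambda>n. padic_abs p (X n)) \<longlonglongrightarrow> lim (\<lambda>n. padic_abs p (X n))"
  using padic_cauchy_convergent by (simp add: convergent_LIMSEQ_iff)

lemma padic_cauchy_bounded:
  assumes "padic_cauchy p X"
  obtains B where "B > 0" "\<And>n. padic_abs p (X n) \<le> B"
proof -
  have "Bseq (\<lambda>n. padic_abs p (X n))"
    using padic_cauchy_convergent[OF assms] by (rule convergent_imp_Bseq)
  then obtain B where B: "B > 0" "\<forall>n. norm (padic_abs p (X n)) \<le> B"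
    by (rule BseqE)
  have "padic_abs p (X n) \<le> B" for n
    using B(2) by (metis abs_ge_self order_trans real_norm_def)
  with B(1) show ?thesis
    by (rule that)
qed

lemma padic_null_mult:
  assumes "padic_cauchy p X" "padic_null p Y"
  shows "padic_null p (\<lambda>n. X n * Y n)"
proof -
  obtain B where "B > 0" "\<And>n. padic_abs p (X n) \<le> B"
    using padic_cauchy_bounded[OF assms(1)] by blast
  hence "padic_abs p (X n * Y n) \<le> B * padic_abs p (Y n)" for n
    by (simp add: padic_abs_mult[OF p] mult_right_mono padic_abs_nonneg[OF p])
  moreover have "(\<lambda>n. B * padic_abs p (Y n)) \<longlonglongrightarrow> 0"
    using assms(2) unfolding padic_null_def by (rule tendsto_mult_right_zero)
  ultimately show ?thesis
    by (intro padic_null_le[of "\<lambda>n. B * padic_abs p (Y n)"]) auto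
qed

lemma padic_cauchy_add:
  assumes "padic_cauchy p X" "padic_cauchy p Y"
  shows "padic_cauchy p (\<lambda>n. X n + Y n)"
  unfolding padic_cauchy_def
proof (intro allI impI)
  fix e :: real assume "e > 0"
  obtain M where M: "\<And>m n. m \<ge> M \<Longrightarrow> n \<ge> M \<Longrightarrow> padic_abs p (X m - X n) < e"
    using assms(1) \<open>e > 0\<close> unfolding padic_cauchy_def by blast
  obtain N where N: "\<And>m n. m \<ge> N \<Longrightarrow> n \<ge> N \<Longrightarrow> padic_abs p (Y m - Y n) < e"
    using assms(2) \<open>e > 0\<close> unfolding padic_cauchy_def by blast
  have "padic_abs p (X m + Y m - (X n + Y n)) < e" if "m \<ge> max M N" "n \<ge> max M N" for m n
    using padic_abs_ultrametric[OF p, of "X m - X n" "Y m - Y n"] M[of m n] N[of m n] that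
    by (simp add: add_diff_add)
  thus "\<exists>N. \<forall>m\<ge>N. \<forall>n\<ge>N. padic_abs p (X m + Y m - (X n + Y n)) < e" by blast
qed

lemma padic_cauchy_minus: "padic_cauchy p X \<Longrightarrow> padic_cauchy p (\<lambda>n. - X n)"
  unfolding padic_cauchy_def minus_diff_minus padic_abs_minus[OF p] .

lemma padic_cauchy_mult:
  assumes "padic_cauchy p X" "padic_cauchy p Y"
  shows "padic_cauchy p (\<lambda>n. X n * Y n)"
  unfolding padic_cauchy_def
proof (intro allI impI)
  fix e :: real assume "e > 0"
  obtain A where A: "A > 0" "\<And>n. padic_abs p (X n) \<le> A"
    using padic_cauchy_bounded[OF assms(1)] by blast
  obtain B where B: "B > 0" "\<And>n. padic_abs p (Y n) \<le> B"
    using padic_cauchy_bounded[OF assms(2)] by blast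
  have "e / B > 0" "e / A > 0" using \<open>e > 0\<close> A B by auto
  obtain M where M: "\<And>m n. m \<ge> M \<Longrightarrow> n \<ge> M \<Longrightarrow> padic_abs p (X m - X n) < e / B"
    using assms(1) \<open>e / B > 0\<close> unfolding padic_cauchy_def by blast
  obtain N where N: "\<And>m n. m \<ge> N \<Longrightarrow> n \<ge> N \<Longrightarrow> padic_abs p (Y m - Y n) < e / A"
    using assms(2) \<open>e / A > 0\<close> unfolding padic_cauchy_def by blast
  have "padic_abs p (X m * Y m - X n * Y n) < e" if mn: "m \<ge> max M N" "n \<ge> max M N" for m n
  proof -
    have "padic_abs p (X m) * padic_abs p (Y m - Y n) \<le> A * padic_abs p (Y m - Y n)"
      using A by (intro mult_right_mono padic_abs_nonneg[OF p])
    also have "\<dots> < e" using N[of m n] mn A by (simp add: field_simps)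
    finally have 1: "padic_abs p (X m * (Y m - Y n)) < e"
      by (simp add: padic_abs_mult[OF p])
    have "padic_abs p (X m - X n) * padic_abs p (Y n) \<le> padic_abs p (X m - X n) * B"
      using B by (intro mult_left_mono padic_abs_nonneg[OF p])
    also have "\<dots> < e" using M[of m n] mn B by (simp add: field_simps)
    finally have 2: "padic_abs p ((X m - X n) * Y n) < e"
      by (simp add: padic_abs_mult[OF p])
    show ?thesis
      using padic_abs_ultrametric[OF p, of "X m * (Y m - Y n)" "(X m - X n) * Y n"] 1 2
      unfolding mult_diff_mult by simp
  qed
  thus "\<exists>N. \<forall>m\<ge>N. \<forall>n\<ge>N. padic_abs p (X m * Y m - X n * Y n) < e" by blast
qed

lemma padic_cauchy_not_null:
  assumes "padic_cauchy p X" "\<not> padic_null p X"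
  obtains c N where "c > 0" "\<And>n. n \<ge> N \<Longrightarrow> padic_abs p (X n) > c"
proof -
  define L where "L = lim (\<lambda>n. padic_abs p (X n))"
  have L: "(\<lambda>n. padic_abs p (X n)) \<longlonglongrightarrow> L"
    using padic_cauchy_tendsto[OF assms(1)] by (simp add: L_def)
  hence "L \<ge> 0" using padic_abs_nonneg[OF p] by (intro LIMSEQ_le_const[OF L]) auto
  moreover have "L \<noteq> 0" using L assms(2) by (auto simp: padic_null_def)
  ultimately have "L > 0" by simp
  hence "\<forall>\<^sub>F n in sequentially. padic_abs p (X n) > L / 2"
    by (intro order_tendstoD(1)[OF L]) auto
  thus ?thesis
    using that[of "L / 2"] \<open>L > 0\<close> by (auto simp: eventually_sequentially)
qed

lemma padic_abs_inverse_diff: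
  assumes "c > 0" "padic_abs p x > c" "padic_abs p y > c"
  shows "padic_abs p (inverse x - inverse y) \<le> padic_abs p (x - y) / c\<^sup>2"
proof -
  have nz: "x \<noteq> 0" "y \<noteq> 0" using assms by auto
  have "padic_abs p (inverse x - inverse y) =
        padic_abs p (x - y) / (padic_abs p x * padic_abs p y)"
    unfolding inverse_diff_inverse[OF nz] padic_abs_minus[OF p] padic_abs_mult[OF p]
      padic_abs_inverse[OF p] by (simp add: divide_simps)
  also have "\<dots> \<le> padic_abs p (x - y) / c\<^sup>2"
    using assms by (intro divide_left_mono padic_abs_nonneg[OF p])
      (auto simp: power2_eq_square intro!: mult_mono mult_pos_pos)
  finally show ?thesis .
qed

lemma padic_cauchy_inverse:
  assumes X: "padic_cauchy p X" "\<not> padic_null p X"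
  shows "padic_cauchy p (\<lambda>n. inverse (X n))"
  unfolding padic_cauchy_def
proof (intro allI impI)
  fix e :: real assume "e > 0"
  obtain c N where c: "c > 0" "\<And>n. n \<ge> N \<Longrightarrow> padic_abs p (X n) > c"
    using padic_cauchy_not_null[OF X] by blast
  have "e * c\<^sup>2 > 0" using \<open>e > 0\<close> c by simp
  then obtain M where M: "\<And>m n. m \<ge> M \<Longrightarrow> n \<ge> M \<Longrightarrow> padic_abs p (X m - X n) < e * c\<^sup>2"
    using X(1) unfolding padic_cauchy_def by blast
  have "padic_abs p (inverse (X m) - inverse (X n)) < e" if mn: "m \<ge> max M N" "n \<ge> max M N" for m n
  proof -
    have "padic_abs p (inverse (X m) - inverse (X n)) \<le> padic_abs p (X m - X n) / c\<^sup>2"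
      using c mn by (intro padic_abs_inverse_diff) auto
    also have "\<dots> < e" using M[of m n] mn c by (simp add: field_simps)
    finally show ?thesis .
  qed
  thus "\<exists>N. \<forall>m\<ge>N. \<forall>n\<ge>N. padic_abs p (inverse (X m) - inverse (X n)) < e" by blast
qed

lemma padic_null_inverse_diff:
  assumes X: "padic_cauchy p X" "\<not> padic_null p X"
    and Y: "padic_cauchy p Y" "\<not> padic_null p Y"
    and XY: "padic_null p (\<lambda>n. X n - Y n)"
  shows "padic_null p (\<lambda>n. inverse (X n) - inverse (Y n))"
proof -
  obtain c M where c: "c > 0" "\<And>n. n \<ge> M \<Longrightarrow> padic_abs p (X n) > c"
    using padic_cauchy_not_null[OF X] by blast
  obtain d N where d: "d > 0" "\<And>n. n \<ge> N \<Longrightarrow> padic_abs p (Y n) > d"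
    using padic_cauchy_not_null[OF Y] by blast
  define e where "e = min c d"
  have e: "e > 0" "\<And>n. n \<ge> max M N \<Longrightarrow> padic_abs p (X n) > e \<and> padic_abs p (Y n) > e"
    using c d by (auto simp: e_def min_less_iff_disj)
  show ?thesis
  proof (rule padic_null_le)
    show "(\<lambda>n. padic_abs p (X n - Y n) / e\<^sup>2) \<longlonglongrightarrow> 0"
      using XY unfolding padic_null_def by (rule tendsto_divide_zero)
    show "\<forall>\<^sub>F n in sequentially. padic_abs p (inverse (X n) - inverse (Y n))
            \<le> padic_abs p (X n - Y n) / e\<^sup>2"
      using e padic_abs_inverse_diff by (intro eventually_sequentiallyI[of "max M N"]) blast
  qed
qed

lemma padic_null_cong:
  assumes "padic_null p (\<lambda>n. X n - Y n)"
  shows "padic_null p X \<longleftrightarrow> padic_null p Y"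
  using padic_null_add[of "\<lambda>n. X n - Y n" Y] padic_null_add[of "\<lambda>n. Y n - X n" X]
    assms padic_null_diff_commute[of X Y] by auto

lemma padic_lim_cong:
  assumes "padic_rel p X Y"
  shows "lim (\<lambda>n. padic_abs p (X n)) = lim (\<lambda>n. padic_abs p (Y n))"
proof -
  have XY: "(\<lambda>n. padic_abs p (X n - Y n)) \<longlonglongrightarrow> 0"
    and Y: "padic_cauchy p Y"
    using assms by (auto simp: padic_rel_def padic_null_def)
  have "(\<lambda>n. padic_abs p (X n) - padic_abs p (Y n)) \<longlonglongrightarrow> 0"
    by (rule Lim_null_comparison[OF _ XY]) (simp add: padic_abs_diff_abs[OF p])
  from tendsto_add[OF this padic_cauchy_tendsto[OF Y]]
  show ?thesis by (simp add: limI)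
qed

lemma part_equivp_padic_rel: "part_equivp (padic_rel p)"
proof (rule part_equivpI)
  show "\<exists>X. padic_rel p X X"
    by (rule exI[of _ "\<lambda>_. 0"]) (simp add: padic_rel_def)
  show "symp (padic_rel p)"
    unfolding symp_def padic_rel_def using padic_null_diff_commute by blast
  show "transp (padic_rel p)"
  proof (rule transpI)
    fix X Y Z assume "padic_rel p X Y" "padic_rel p Y Z"
    thus "padic_rel p X Z"
      using padic_null_add[of "\<lambda>n. X n - Y n" "\<lambda>n. Y n - Z n"] by (auto simp: padic_rel_def)
  qed
qed

end


section \<open>The field of \<open>p\<close>-adic numbers\<close>

text \<open>
  \<open>'p padic\<close> is the field of \<open>p\<close>-adic numbers for the prime \<open>p = CARD('p)\<close>: the completion of the
  rationals with respect to the \<open>p\<close>-adic absolute value.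
\<close>

typedef (overloaded) 'p padic =
  "{C. \<exists>X. padic_cauchy CARD('p::prime_card) X \<and> C = {Y. padic_rel CARD('p) X Y}}"
  morphisms padic_class Abs_padic
  by (auto intro: exI[of _ "\<lambda>_. 0"])

definition cr_padic :: "(nat \<Rightarrow> rat) \<Rightarrow> 'p::prime_card padic \<Rightarrow> bool" where
  "cr_padic X x \<longleftrightarrow> X \<in> padic_class x"

definition rep_padic :: "'p::prime_card padic \<Rightarrow> nat \<Rightarrow> rat" where
  "rep_padic x = (SOME X. X \<in> padic_class x)"

definition padic_of_seq :: "(nat \<Rightarrow> rat) \<Rightarrow> 'p::prime_card padic" where
  "padic_of_seq X = Abs_padic {Y. padic_rel CARD('p) X Y}"

lemma Quotient_padic:
  "Quotient (padic_rel CARD('p)) padic_of_seq rep_padic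
     (cr_padic :: (nat \<Rightarrow> rat) \<Rightarrow> 'p::prime_card padic \<Rightarrow> bool)"
proof -
  let ?R = "padic_rel CARD('p)"
  have equiv: "part_equivp ?R"
    by (rule part_equivp_padic_rel[OF prime_card])
  have sym: "?R Y X" if "?R X Y" for X Y
    using that by (rule part_equivp_symp[OF equiv])
  have trans: "?R X Z" if "?R X Y" "?R Y Z" for X Y Z
    using that by (rule part_equivp_transp[OF equiv])
  have refl: "?R X X \<longleftrightarrow> padic_cauchy CARD('p) X" for X
    by (simp add: padic_rel_def)
  have class_of: "padic_class (padic_of_seq X :: 'p padic) = {Y. ?R X Y}" if "?R X X" for X
    unfolding padic_of_seq_def using that refl by (subst Abs_padic_inverse) auto
  have ex: "\<exists>X. ?R X X \<and> x = padic_of_seq X" for x :: "'p padic"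
  proof -
    obtain X where X: "padic_cauchy CARD('p) X" "padic_class x = {Y. ?R X Y}"
      using padic_class[of x] by blast
    hence "x = padic_of_seq X"
      unfolding padic_of_seq_def by (simp flip: X(2) add: padic_class_inverse)
    with X(1) show ?thesis unfolding refl by blast
  qed
  have mem: "X \<in> padic_class x \<longleftrightarrow> ?R X X \<and> padic_of_seq X = x" for X and x :: "'p padic"
  proof -
    obtain Y where Y: "?R Y Y" "x = padic_of_seq Y" using ex by blast
    have "X \<in> padic_class x \<longleftrightarrow> ?R Y X" using Y class_of by simp
    also have "\<dots> \<longleftrightarrow> ?R X X \<and> {Z. ?R X Z} = {Z. ?R Y Z}"
      using sym trans by blast
    also have "\<dots> \<longleftrightarrow> ?R X X \<and> padic_of_seq X = x"
      using class_of Y padic_class_inject[of "padic_of_seq X" x] by auto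
    finally show ?thesis .
  qed
  have rep: "rep_padic x \<in> padic_class x" for x :: "'p padic"
    unfolding rep_padic_def using ex mem by (metis someI_ex)
  have R: "?R X Y \<longleftrightarrow> ?R X X \<and> ?R Y Y \<and> (padic_of_seq X :: 'p padic) = padic_of_seq Y" for X Y
  proof -
    have "?R X Y \<longleftrightarrow> ?R X X \<and> Y \<in> padic_class (padic_of_seq X :: 'p padic)"
      using class_of sym trans by blast
    thus ?thesis by (auto simp: mem)
  qed
  show ?thesis
  proof (rule QuotientI)
    show "padic_of_seq (rep_padic x) = x" for x :: "'p padic" using rep mem by blast
    show "?R (rep_padic x) (rep_padic x)" for x :: "'p padic" using rep mem by blast
    show "?R X Y = (?R X X \<and> ?R Y Y \<and> (padic_of_seq X :: 'p padic) = padic_of_seq Y)" for X Y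
      by (rule R)
    show "(cr_padic :: _ \<Rightarrow> 'p padic \<Rightarrow> bool) = (\<lambda>X x. ?R X X \<and> padic_of_seq X = x)"
      by (intro ext) (simp add: cr_padic_def mem)
  qed
qed

setup_lifting Quotient_padic

instantiation padic :: (prime_card) field
begin

lift_definition zero_padic :: "'a padic" is "\<lambda>_. 0"
  by (simp add: padic_rel_def)

lift_definition one_padic :: "'a padic" is "\<lambda>_. 1"
  by (simp add: padic_rel_def)

lift_definition plus_padic :: "'a padic \<Rightarrow> 'a padic \<Rightarrow> 'a padic" is "\<lambda>X Y n. X n + Y n"
  unfolding padic_rel_def add_diff_add
  by (simp add: padic_cauchy_add[OF prime_card] padic_null_add[OF prime_card])

lift_definition uminus_padic :: "'a padic \<Rightarrow> 'a padic" is "\<lambda>X n. - X n"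
  unfolding padic_rel_def minus_diff_minus
  by (simp add: padic_cauchy_minus[OF prime_card] padic_null_minus[OF prime_card]
      del: minus_diff_eq)

definition minus_padic :: "'a padic \<Rightarrow> 'a padic \<Rightarrow> 'a padic" where
  "minus_padic x y = x + - y"

lift_definition times_padic :: "'a padic \<Rightarrow> 'a padic \<Rightarrow> 'a padic" is "\<lambda>X Y n. X n * Y n"
proof -
  fix X X' Y Y' assume *: "padic_rel CARD('a) X X'" "padic_rel CARD('a) Y Y'"
  have "padic_null CARD('a) (\<lambda>n. X n * (Y n - Y' n) + Y' n * (X n - X' n))"
    using * by (intro padic_null_add[OF prime_card] padic_null_mult[OF prime_card])
      (auto simp: padic_rel_def)
  thus "padic_rel CARD('a) (\<lambda>n. X n * Y n) (\<lambda>n. X' n * Y' n)"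
    using * by (simp add: padic_rel_def padic_cauchy_mult[OF prime_card] mult_diff_mult mult.commute)
qed

lift_definition inverse_padic :: "'a padic \<Rightarrow> 'a padic"
  is "\<lambda>X. if padic_null CARD('a) X then (\<lambda>_. 0) else (\<lambda>n. inverse (X n))"
proof -
  fix X Y assume *: "padic_rel CARD('a) X Y"
  hence "padic_null CARD('a) X \<longleftrightarrow> padic_null CARD('a) Y"
    by (intro padic_null_cong[OF prime_card]) (simp add: padic_rel_def)
  thus "padic_rel CARD('a) (if padic_null CARD('a) X then (\<lambda>_. 0) else (\<lambda>n. inverse (X n)))
          (if padic_null CARD('a) Y then (\<lambda>_. 0) else (\<lambda>n. inverse (Y n)))"
    using * by (auto simp: padic_rel_def padic_cauchy_inverse[OF prime_card]
        padic_null_inverse_diff[OF prime_card])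
qed

definition divide_padic :: "'a padic \<Rightarrow> 'a padic \<Rightarrow> 'a padic" where
  "divide_padic x y = x * inverse y"

instance
proof
  fix a b c :: "'a padic"
  note [simp] = padic_rel_def padic_cauchy_add[OF prime_card] padic_cauchy_mult[OF prime_card]
    padic_cauchy_minus[OF prime_card]
  show "a + b = b + a" by transfer (simp add: add.commute)
  show "(a + b) + c = a + (b + c)" by transfer (simp add: add.assoc)
  show "0 + a = a" by transfer simp
  show "- a + a = 0" by transfer simp
  show "a - b = a + - b" by (rule minus_padic_def)
  show "(a * b) * c = a * (b * c)" by transfer (simp add: mult.assoc)
  show "a * b = b * a" by transfer (simp add: mult.commute)
  show "1 * a = a" by transfer simp
  show "(a + b) * c = a * c + b * c" by transfer (simp add: distrib_right)
  show "(0 :: 'a padic) \<noteq> 1"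
    by transfer (simp add: padic_null_const_iff[OF prime_card])
  show "a \<noteq> 0 \<Longrightarrow> inverse a * a = 1"
  proof transfer
    fix X assume "padic_rel CARD('a) X X" "\<not> padic_rel CARD('a) X (\<lambda>_. 0)"
    hence X: "padic_cauchy CARD('a) X" "\<not> padic_null CARD('a) X" by auto
    obtain c N where c: "c > 0" "\<And>n. n \<ge> N \<Longrightarrow> padic_abs CARD('a) (X n) > c"
      using padic_cauchy_not_null[OF prime_card X] by blast
    have "padic_null CARD('a) (\<lambda>n. inverse (X n) * X n - 1)"
    proof (rule padic_null_le[OF prime_card])
      show "(\<lambda>_. 0 :: real) \<longlonglongrightarrow> 0" by simp
      have "inverse (X n) * X n - 1 = 0" if "n \<ge> N" for n
        using c(2)[OF that] c(1) by (cases "X n = 0") auto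
      thus "\<forall>\<^sub>F n in sequentially. padic_abs CARD('a) (inverse (X n) * X n - 1) \<le> 0"
        by (intro eventually_sequentiallyI[of N]) simp
    qed
    thus "padic_rel CARD('a) (\<lambda>n. (if padic_null CARD('a) X then \<lambda>_. 0 else (\<lambda>n. inverse (X n))) n * X n) (\<lambda>_. 1)"
      using X padic_cauchy_inverse[OF prime_card X] by auto
  qed
  show "a div b = a * inverse b" by (rule divide_padic_def)
  show "inverse (0 :: 'a padic) = 0" by transfer simp
qed

end

text \<open>The absolute value extends to the completion as the limit along a representing sequence.\<close>

lift_definition padic_norm :: "'p::prime_card padic \<Rightarrow> real" is
  "\<lambda>X. lim (\<lambda>n. padic_abs CARD('p) (X n))"
  by (rule padic_lim_cong[OF prime_card])

lemma padic_norm_eq_0_iff: "padic_norm (x :: 'p::prime_card padic) = 0 \<longleftrightarrow> x = 0"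
proof transfer
  fix X assume "padic_rel CARD('p) X X"
  hence X: "padic_cauchy CARD('p) X" by (simp add: padic_rel_def)
  show "lim (\<lambda>n. padic_abs CARD('p) (X n)) = 0 \<longleftrightarrow> padic_rel CARD('p) X (\<lambda>_. 0)"
  proof
    assume "lim (\<lambda>n. padic_abs CARD('p) (X n)) = 0"
    hence "padic_null CARD('p) X"
      using padic_cauchy_tendsto[OF prime_card X] unfolding padic_null_def by metis
    thus "padic_rel CARD('p) X (\<lambda>_. 0)" using X by (simp add: padic_rel_def)
  next
    assume "padic_rel CARD('p) X (\<lambda>_. 0)"
    hence "(\<lambda>n. padic_abs CARD('p) (X n)) \<longlonglongrightarrow> 0"
      by (simp add: padic_rel_def padic_null_def)
    thus "lim (\<lambda>n. padic_abs CARD('p) (X n)) = 0" by (rule limI)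
  qed
qed

lemma padic_norm_minus: "padic_norm (- x) = padic_norm (x :: 'p::prime_card padic)"
  by transfer (simp add: padic_abs_minus[OF prime_card])

lemma padic_norm_mult: "padic_norm (x * y) = padic_norm x * padic_norm (y :: 'p::prime_card padic)"
proof transfer
  fix X Y assume "padic_rel CARD('p) X X" "padic_rel CARD('p) Y Y"
  hence "padic_cauchy CARD('p) X" "padic_cauchy CARD('p) Y" by (auto simp: padic_rel_def)
  from tendsto_mult[OF this[THEN padic_cauchy_tendsto[OF prime_card]]]
  show "lim (\<lambda>n. padic_abs CARD('p) (X n * Y n)) =
      lim (\<lambda>n. padic_abs CARD('p) (X n)) * lim (\<lambda>n. padic_abs CARD('p) (Y n))"
    by (simp add: padic_abs_mult[OF prime_card] limI)
qed

lemma padic_norm_ultrametric: "padic_norm (x + y) \<le> max (padic_norm x) (padic_norm (y :: 'p::prime_card padic))"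
proof transfer
  fix X Y assume "padic_rel CARD('p) X X" "padic_rel CARD('p) Y Y"
  hence X: "padic_cauchy CARD('p) X" and Y: "padic_cauchy CARD('p) Y" by (auto simp: padic_rel_def)
  note lims = padic_cauchy_tendsto[OF prime_card]
  show "lim (\<lambda>n. padic_abs CARD('p) (X n + Y n)) \<le>
      max (lim (\<lambda>n. padic_abs CARD('p) (X n))) (lim (\<lambda>n. padic_abs CARD('p) (Y n)))"
    by (rule LIMSEQ_le[OF lims[OF padic_cauchy_add[OF prime_card X Y]]
          tendsto_max[OF lims[OF X] lims[OF Y]]])
       (use padic_abs_ultrametric[OF prime_card] in blast)
qed

lemma padic_norm_nonneg: "padic_norm (x :: 'p::prime_card padic) \<ge> 0"
  using padic_norm_ultrametric[of x "- x"] padic_norm_eq_0_iff[of "0 :: 'p padic"]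
  by (simp add: padic_norm_minus)

instantiation padic :: (prime_card) metric_space
begin

definition dist_padic :: "'a padic \<Rightarrow> 'a padic \<Rightarrow> real" where
  "dist_padic x y = padic_norm (x - y)"

definition uniformity_padic :: "('a padic \<times> 'a padic) filter" where
  "uniformity_padic = (INF e\<in>{0<..}. principal {(x, y). dist x y < e})"

definition open_padic :: "'a padic set \<Rightarrow> bool" where
  "open_padic U \<longleftrightarrow> (\<forall>x\<in>U. eventually (\<lambda>(x', y). x' = x \<longrightarrow> y \<in> U) uniformity)"

instance
proof
  fix x y z :: "'a padic" and U :: "'a padic set"
  show "uniformity = (INF e\<in>{0<..}. principal {(x :: 'a padic, y). dist x y < e})"
    by (rule uniformity_padic_def)
  show "open U \<longleftrightarrow> (\<forall>x\<in>U. eventually (\<lambda>(x', y). x' = x \<longrightarrow> y \<in> U) uniformity)"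
    by (rule open_padic_def)
  show "dist x y = 0 \<longleftrightarrow> x = y" by (simp add: dist_padic_def padic_norm_eq_0_iff)
  show "dist x y \<le> dist x z + dist y z"
    using padic_norm_ultrametric[of "x - z" "z - y"] padic_norm_minus[of "y - z"]
      padic_norm_nonneg[of "x - z"] padic_norm_nonneg[of "y - z"]
    by (simp add: dist_padic_def)
qed

end


section \<open>\<open>p\<close>-adic integers and order of convergence\<close>

definition padic_ints :: "'p::prime_card padic set" where
  "padic_ints = {x. padic_norm x \<le> 1}"

definition padic_int_units :: "'p::prime_card padic set" where
  "padic_int_units = {u \<in> padic_ints. \<exists>v\<in>padic_ints. u * v = 1}"

text \<open>
  \<open>R\<^sub>n\<close> is undefined when \<open>X n = \<gamma>\<close>, where division in HOL would silently yield 0. The last conjunct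
  excludes a sequence that reaches \<open>\<gamma>\<close> and leaves it again, so that boundedness of \<open>R\<^sub>n\<close> means
  \<open>dist (X (n + 1)) \<gamma> \<le> C * dist (X n) \<gamma> ^ q\<close> for all \<open>n\<close> and some constant \<open>C\<close>.
\<close>

definition converges_with_order ::
    "(nat \<Rightarrow> 'a::metric_space) \<Rightarrow> 'a \<Rightarrow> nat \<Rightarrow> bool" where
  "converges_with_order X \<gamma> q \<longleftrightarrow>
     X \<longlonglongrightarrow> \<gamma> \<and>
     Bseq (\<lambda>n. dist (X (Suc n)) \<gamma> / dist (X n) \<gamma> ^ q) \<and>
     (\<forall>n. X n = \<gamma> \<longrightarrow> X (Suc n) = \<gamma>)"

end

theory Submission
  imports Defs
begin

text \<open>
  Write \<open>F = f(x\<^sub>n)\<close> and \<open>G = f'(x\<^sub>n)\<close>. The iteration step agrees with the root of the Taylor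
  polynomial of degree three closely enough that \<open>f(x\<^sub>n\<^sub>+\<^sub>1) = (F / G\<^sup>2)\<^sup>4 G\<^sup>2 c\<close> with \<open>c\<close> integral, while
  \<open>|x\<^sub>n\<^sub>+\<^sub>1 - x\<^sub>n| = |F / G| < |G|\<close> keeps \<open>|f'(x\<^sub>n)| = s\<close> constant. Hence \<open>|f(x\<^sub>n)|\<close> decreases to \<open>0\<close>, the
  sequence is Cauchy, and its limit \<open>\<gamma>\<close> is a root with \<open>|f'(\<gamma>)| = s\<close>. Since \<open>|x\<^sub>n - \<gamma>| = |f(x\<^sub>n)| / s\<close>,
  the quartic bound on \<open>f(x\<^sub>n\<^sub>+\<^sub>1)\<close> is order four convergence.
\<close>

section \<open>The ring of \<open>p\<close>-adic integers\<close>

lemma padic_norm_0 [simp]: "padic_norm 0 = 0"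
  by (simp add: padic_norm_eq_0_iff)

lemma padic_norm_pos_iff: "padic_norm x > 0 \<longleftrightarrow> x \<noteq> 0"
  using padic_norm_nonneg[of x] padic_norm_eq_0_iff[of x] by linarith

lemma padic_norm_1 [simp]: "padic_norm (1 :: 'p::prime_card padic) = 1"
  using padic_norm_mult[of 1 "1 :: 'p padic"] padic_norm_eq_0_iff[of "1 :: 'p padic"] by simp

lemma padic_norm_power: "padic_norm (x ^ n) = padic_norm x ^ n"
  by (induction n) (simp_all add: padic_norm_mult)

lemma padic_norm_inverse: "padic_norm (inverse x) = inverse (padic_norm x)"
proof (cases "x = 0")
  case False
  hence "padic_norm x * padic_norm (inverse x) = 1"
    by (simp flip: padic_norm_mult)
  thus ?thesis by (metis inverse_unique)
qed simp

lemma padic_norm_divide: "padic_norm (x / y) = padic_norm x / padic_norm y"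
  by (simp add: divide_inverse padic_norm_mult padic_norm_inverse)

lemma padic_norm_diff_ultrametric: "padic_norm (x - y) \<le> max (padic_norm x) (padic_norm y)"
  using padic_norm_ultrametric[of x "- y"] by (simp add: padic_norm_minus)

text \<open>Write \<open>x = (x + y) - y\<close>. As \<open>y\<close> is too small to account for
  the size of \<open>x\<close>, the ultrametric inequality forces \<open>x + y\<close> to be at
  least as large as \<open>x\<close>. All later claims that a perturbation leaves an absolute value
  unchanged rest on this.\<close>

lemma padic_norm_add_eq:
  assumes "padic_norm y < padic_norm x"
  shows "padic_norm (x + y) = padic_norm x"
  using padic_norm_ultrametric[of x y] padic_norm_diff_ultrametric[of "x + y" y] assms by simp

lemma padic_ints_iff: "x \<in> padic_ints \<longleftrightarrow> padic_norm x \<le> 1"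
  by (simp add: padic_ints_def)

lemma padic_ints_0 [simp, intro]: "0 \<in> padic_ints"
  and padic_ints_1 [simp, intro]: "1 \<in> padic_ints"
  by (simp_all add: padic_ints_iff)

lemma padic_ints_add [intro]: "x \<in> padic_ints \<Longrightarrow> y \<in> padic_ints \<Longrightarrow> x + y \<in> padic_ints"
  using padic_norm_ultrametric[of x y] by (simp add: padic_ints_iff)

lemma padic_ints_minus [intro]: "x \<in> padic_ints \<Longrightarrow> - x \<in> padic_ints"
  by (simp add: padic_ints_iff padic_norm_minus)

lemma padic_ints_diff [intro]: "x \<in> padic_ints \<Longrightarrow> y \<in> padic_ints \<Longrightarrow> x - y \<in> padic_ints"
  using padic_norm_diff_ultrametric[of x y] by (simp add: padic_ints_iff)

lemma padic_ints_mult [intro]: "x \<in> padic_ints \<Longrightarrow> y \<in> padic_ints \<Longrightarrow> x * y \<in> padic_ints"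
  by (simp add: padic_ints_iff padic_norm_mult mult_le_one padic_norm_nonneg)

lemma padic_ints_power [intro]: "x \<in> padic_ints \<Longrightarrow> x ^ n \<in> padic_ints"
  by (induction n) auto

lemma padic_ints_of_nat [simp, intro]: "of_nat n \<in> padic_ints"
  by (induction n) auto

lemma padic_ints_numeral [simp, intro]: "numeral n \<in> padic_ints"
  using padic_ints_of_nat[of "numeral n"] by simp

section \<open>Embedding of the rationals by constant sequences, and absolute values of small
  integers\<close>

lift_definition padic_of_rat :: "rat \<Rightarrow> 'p::prime_card padic" is "\<lambda>r _. r"
  by (simp add: padic_rel_def)

lemma padic_norm_of_rat: "padic_norm (padic_of_rat r :: 'p::prime_card padic) = padic_abs CARD('p) r"
  by transfer simp

lemma padic_of_rat_of_nat: "padic_of_rat (of_nat n) = (of_nat n :: 'p::prime_card padic)"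
proof (induction n)
  case 0
  show ?case by (simp, transfer) (simp add: padic_rel_def)
next
  case (Suc n)
  have "padic_of_rat (of_nat (Suc n)) = (1 + padic_of_rat (of_nat n) :: 'p padic)"
    by transfer (simp add: padic_rel_def)
  with Suc show ?case by simp
qed

text \<open>The norm on constants is \<open>padic_abs\<close>, and the exponent of the prime in
  \<open>n\<close> is 0. This is needed for \<open>n = 2\<close> and \<open>n = 3\<close>.\<close>

lemma padic_norm_of_nat_coprime:
  assumes "coprime n CARD('p)"
  shows "padic_norm (of_nat n :: 'p::prime_card padic) = 1"
proof -
  have p: "prime CARD('p)" by (rule prime_card)
  have n: "n \<noteq> 0" using assms p by (intro notI) auto
  have "\<not> int CARD('p) dvd int n"
    using assms p by (metis coprime_common_divisor_nat dvd_refl int_dvd_int_iff not_prime_1 nat_dvd_1_iff_1)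
  hence "multiplicity (int CARD('p)) (int n) = 0"
    by (rule not_dvd_imp_multiplicity_0)
  hence "padic_abs CARD('p) (of_nat n) = 1"
    using padic_abs_of_int_divide[OF p, of "int n" 1] n by simp
  thus ?thesis by (simp flip: padic_of_rat_of_nat add: padic_norm_of_rat)
qed

lemma padic_norm_2:
  assumes "CARD('p) > 2"
  shows "padic_norm (2 :: 'p::prime_card padic) = 1"
proof -
  have "coprime 2 CARD('p)"
    using assms prime_card[where 'a='p] by (intro primes_coprime) auto
  thus ?thesis using padic_norm_of_nat_coprime[of 2, where 'p='p] by simp
qed

lemma padic_norm_3:
  assumes "CARD('p) > 3"
  shows "padic_norm (3 :: 'p::prime_card padic) = 1"
proof -
  have "coprime 3 CARD('p)"
    using assms prime_card[where 'a='p] by (intro primes_coprime) auto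
  thus ?thesis using padic_norm_of_nat_coprime[of 3, where 'p='p] by simp
qed

section \<open>Completeness\<close>

text \<open>The distance from \<open>X n\<close> to the class of \<open>X\<close> is the limit over
  \<open>k\<close> of the absolute value of \<open>X n - X k\<close>, which the Cauchy condition
  bounds. Limits preserve only weak inequalities, hence the \<open>e / 2\<close>.\<close>

lemma padic_of_rat_tendsto:
  assumes "padic_cauchy CARD('p) X"
  shows "(\<lambda>n. padic_of_rat (X n) :: 'p::prime_card padic) \<longlonglongrightarrow> padic_of_seq X"
proof (rule metric_LIMSEQ_I)
  fix e :: real assume "e > 0"
  then obtain N where N: "\<And>m n. m \<ge> N \<Longrightarrow> n \<ge> N \<Longrightarrow> padic_abs CARD('p) (X m - X n) < e / 2"
    using assms unfolding padic_cauchy_def by (meson half_gt_zero)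
  have "dist (padic_of_rat (X n)) (padic_of_seq X :: 'p padic) < e" if "n \<ge> N" for n
  proof -
    have neg: "padic_cauchy CARD('p) (\<lambda>k. - X k)"
      by (rule padic_cauchy_minus[OF prime_card assms])
    have diff: "padic_cauchy CARD('p) (\<lambda>k. X n + - X k)"
      by (rule padic_cauchy_add[OF prime_card padic_cauchy_const neg])
    have "dist (padic_of_rat (X n)) (padic_of_seq X :: 'p padic)
        = lim (\<lambda>k. padic_abs CARD('p) (X n + - X k))"
      using assms neg diff
      by (simp add: dist_padic_def minus_padic_def padic_of_rat.abs_eq uminus_padic.abs_eq
          plus_padic.abs_eq padic_norm.abs_eq padic_rel_def)
    also have "\<dots> \<le> e / 2"
      using N[OF that]
      by (intro LIMSEQ_le_const2[OF padic_cauchy_tendsto[OF prime_card diff]] exI[of _ N])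
        (auto intro: less_imp_le)
    finally show ?thesis using \<open>e > 0\<close> by simp
  qed
  thus "\<exists>N. \<forall>n\<ge>N. dist (padic_of_rat (X n)) (padic_of_seq X :: 'p padic) < e"
    by blast
qed

lemma padic_of_rat_dense:
  fixes x :: "'p::prime_card padic"
  assumes "e > 0"
  shows "\<exists>r. dist (padic_of_rat r) x < e"
proof -
  have "padic_rel CARD('p) (rep_padic x) (rep_padic x)"
    by (rule Quotient_rep_reflp[OF Quotient_padic])
  hence "padic_cauchy CARD('p) (rep_padic x)"
    by (simp add: padic_rel_def)
  from metric_LIMSEQ_D[OF padic_of_rat_tendsto[OF this] assms] show ?thesis
    unfolding Quotient_abs_rep[OF Quotient_padic] by blast
qed

lemma dist_padic_of_rat:
  "dist (padic_of_rat r) (padic_of_rat s :: 'p::prime_card padic) = padic_abs CARD('p) (r - s)"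
  unfolding dist_padic_def minus_padic_def by transfer simp

text \<open>Approximate the n-th term by a rational \<open>X n\<close> with error below
  \<open>1 / (n + 1)\<close>. These rationals form a Cauchy sequence, and the element that it
  represents is the required limit.\<close>

instance padic :: (prime_card) complete_space
proof
  fix x :: "nat \<Rightarrow> 'a padic" assume x: "Cauchy x"
  have "\<exists>r. dist (padic_of_rat r) (x n) < inverse (real (Suc n))" for n
    by (rule padic_of_rat_dense) simp
  then obtain X where X: "\<And>n. dist (padic_of_rat (X n)) (x n) < inverse (real (Suc n))"
    by metis
  have "(\<lambda>n. dist (padic_of_rat (X n)) (x n)) \<longlonglongrightarrow> 0"
    using X by (intro tendsto_sandwich[OF _ _ tendsto_const LIMSEQ_inverse_real_of_nat]
        always_eventually allI less_imp_le[of "dist _ _"]) simp_all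
  note close = this
  have "padic_cauchy CARD('a) X"
    unfolding padic_cauchy_def
  proof (intro allI impI)
    fix e :: real assume "e > 0"
    hence e: "e / 3 > 0" by simp
    obtain M where M: "\<And>m n. m \<ge> M \<Longrightarrow> n \<ge> M \<Longrightarrow> dist (x m) (x n) < e / 3"
      using metric_CauchyD[OF x e] by blast
    obtain N where N: "\<And>n. n \<ge> N \<Longrightarrow> dist (padic_of_rat (X n)) (x n) < e / 3"
      using metric_LIMSEQ_D[OF close e] by auto
    have "padic_abs CARD('a) (X m - X n) < e" if "m \<ge> max M N" "n \<ge> max M N" for m n
    proof -
      have "dist (padic_of_rat (X m)) (padic_of_rat (X n) :: 'a padic) \<le>
          dist (padic_of_rat (X m)) (x m) + dist (x m) (x n) + dist (padic_of_rat (X n)) (x n)"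
        by (meson add_mono dist_triangle dist_triangle2 order_refl order_trans)
      thus ?thesis
        using M[of m n] N[of m] N[of n] that by (simp add: dist_padic_of_rat)
    qed
    thus "\<exists>N. \<forall>m\<ge>N. \<forall>n\<ge>N. padic_abs CARD('a) (X m - X n) < e" by blast
  qed
  from padic_of_rat_tendsto[OF this]
  have "(\<lambda>n. dist (padic_of_rat (X n)) (padic_of_seq X :: 'a padic)) \<longlonglongrightarrow> 0"
    by (rule tendsto_dist_iff[THEN iffD1])
  from tendsto_add[OF close this]
  have "(\<lambda>n. dist (padic_of_rat (X n)) (x n) +
      dist (padic_of_rat (X n)) (padic_of_seq X :: 'a padic)) \<longlonglongrightarrow> 0"
    by simp
  hence "(\<lambda>n. dist (x n) (padic_of_seq X)) \<longlonglongrightarrow> 0"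
    by (rule tendsto_sandwich[OF _ _ tendsto_const, rotated 2]) (simp_all add: dist_triangle3)
  thus "convergent x"
    by (intro convergentI) (rule tendsto_dist_iff[THEN iffD2])
qed

section \<open>Taylor expansion with integral remainder\<close>

lemma poly_padic_int:
  assumes "\<forall>i. Polynomial.coeff f i \<in> padic_ints" "x \<in> padic_ints"
  shows "poly f x \<in> padic_ints"
  using assms(1)
proof (induction f)
  case (pCons a f)
  have "a \<in> padic_ints" using pCons.prems[rule_format, of 0] by simp
  moreover have "\<forall>i. Polynomial.coeff f i \<in> padic_ints"
    using pCons.prems by (metis coeff_pCons_Suc)
  ultimately show ?case using pCons.IH assms(2) by auto
qed simp

lemma coeff_pderiv_padic_int:
  assumes "\<forall>i. Polynomial.coeff f i \<in> padic_ints"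
  shows "\<forall>i. Polynomial.coeff (pderiv f) i \<in> padic_ints"
  unfolding coeff_pderiv by (intro allI padic_ints_mult padic_ints_of_nat assms[rule_format])

text \<open>Leibniz rule for the product of the indeterminate with \<open>f\<close>: only two terms
  survive because the second derivative of the indeterminate is zero.\<close>

lemma higher_pderiv_pCons:
  "(pderiv ^^ Suc n) (pCons a f) = Polynomial.smult (of_nat (Suc n)) ((pderiv ^^ n) f) + pCons 0 ((pderiv ^^ Suc n) f)"
proof (induction n)
  case (Suc n)
  have "(pderiv ^^ Suc (Suc n)) (pCons a f) = pderiv ((pderiv ^^ Suc n) (pCons a f))"
    by simp
  also have "\<dots> = Polynomial.smult (of_nat (Suc (Suc n))) ((pderiv ^^ Suc n) f) + pCons 0 ((pderiv ^^ Suc (Suc n)) f)"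
    unfolding Suc.IH by (simp add: pderiv_add pderiv_smult pderiv_pCons smult_add_left ac_simps)
  finally show ?case .
qed (simp add: pderiv_pCons)

text \<open>Induction over the coefficients yields integrality of \<open>H\<close>, \<open>K\<close>
  and \<open>r\<close> without dividing by factorials. \<open>H\<close> and \<open>K\<close> are
  fixed before \<open>d\<close>, because the displacement used later is itself built from
  them.\<close>

lemma taylor_padic_int:
  assumes "\<forall>i. Polynomial.coeff f i \<in> padic_ints" "x \<in> padic_ints"
  obtains H K where "H \<in> padic_ints" "K \<in> padic_ints"
    "poly ((pderiv ^^ 2) f) x = 2 * H" "poly ((pderiv ^^ 3) f) x = 6 * K"
    "\<And>d. d \<in> padic_ints \<Longrightarrow> \<exists>r\<in>padic_ints.
      poly f (x + d) = poly f x + poly (pderiv f) x * d + H * d ^ 2 + K * d ^ 3 + r * d ^ 4"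
proof -
  have "\<exists>H\<in>padic_ints. \<exists>K\<in>padic_ints.
    poly ((pderiv ^^ 2) f) x = 2 * H \<and> poly ((pderiv ^^ 3) f) x = 6 * K \<and>
    (\<forall>d\<in>padic_ints. \<exists>r\<in>padic_ints.
      poly f (x + d) = poly f x + poly (pderiv f) x * d + H * d ^ 2 + K * d ^ 3 + r * d ^ 4)"
    using assms(1)
  proof (induction f)
    case 0
    show ?case by (intro bexI[of _ 0]) (auto simp: eval_nat_numeral)
  next
    case (pCons a f)
    have f: "\<forall>i. Polynomial.coeff f i \<in> padic_ints"
      using pCons.prems by (metis coeff_pCons_Suc)
    then obtain H K where ints: "H \<in> padic_ints" "K \<in> padic_ints"
      and eq: "poly ((pderiv ^^ 2) f) x = 2 * H" "poly ((pderiv ^^ 3) f) x = 6 * K"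
      and taylor: "\<And>d. d \<in> padic_ints \<Longrightarrow> \<exists>r\<in>padic_ints.
        poly f (x + d) = poly f x + poly (pderiv f) x * d + H * d ^ 2 + K * d ^ 3 + r * d ^ 4"
      using pCons.IH by blast
    have "poly (pderiv f) x \<in> padic_ints"
      by (intro poly_padic_int coeff_pderiv_padic_int f assms(2))
    hence ints': "poly (pderiv f) x + x * H \<in> padic_ints" "H + x * K \<in> padic_ints"
      using ints assms(2) by auto
    have eq2: "poly ((pderiv ^^ 2) (pCons a f)) x = 2 * (poly (pderiv f) x + x * H)"
      using eq(1) higher_pderiv_pCons[of 1 a f] by (simp add: numeral_2_eq_2 algebra_simps)
    have eq3: "poly ((pderiv ^^ 3) (pCons a f)) x = 6 * (H + x * K)"
      using eq higher_pderiv_pCons[of 2 a f] by (simp add: numeral_3_eq_3 numeral_2_eq_2 algebra_simps)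
    have "\<exists>r\<in>padic_ints. poly (pCons a f) (x + d) =
        poly (pCons a f) x + poly (pderiv (pCons a f)) x * d
          + (poly (pderiv f) x + x * H) * d ^ 2 + (H + x * K) * d ^ 3 + r * d ^ 4"
      if d: "d \<in> padic_ints" for d
    proof -
      obtain r where "r \<in> padic_ints"
        and r: "poly f (x + d) = poly f x + poly (pderiv f) x * d + H * d ^ 2 + K * d ^ 3 + r * d ^ 4"
        using taylor[OF d] by blast
      \<comment> \<open>Multiplying the expansion of \<open>f\<close> by \<open>x + d\<close> moves
        \<open>K * d ^ 3\<close> up to degree four, where it joins the remainder.\<close>
      hence int: "K + (x + d) * r \<in> padic_ints"
        using ints d assms(2) by blast
      have "poly (pCons a f) (x + d) = a + (x + d) *
          (poly f x + poly (pderiv f) x * d + H * d ^ 2 + K * d ^ 3 + r * d ^ 4)"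
        by (simp add: r)
      also have "\<dots> = poly (pCons a f) x + poly (pderiv (pCons a f)) x * d
          + (poly (pderiv f) x + x * H) * d ^ 2 + (H + x * K) * d ^ 3 + (K + (x + d) * r) * d ^ 4"
        by (simp add: pderiv_pCons algebra_simps eval_nat_numeral)
      finally show ?thesis using int by (rule bexI)
    qed
    with ints' eq2 eq3 show ?case
      by - (rule bexI[of _ "poly (pderiv f) x + x * H"], rule bexI[of _ "H + x * K"], intro conjI ballI)
  qed
  thus thesis by (elim bexE conjE) (rule that, assumption+, erule bspec, assumption)
qed

text \<open>All terms beyond the linear one are collected in \<open>r\<close>. The factor
  \<open>d\<close> is pulled out so that multiplicativity of the norm applies directly.\<close>

lemma taylor1_padic_int:
  assumes "\<forall>i. Polynomial.coeff f i \<in> padic_ints" "x \<in> padic_ints" "d \<in> padic_ints"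
  obtains r where "r \<in> padic_ints" "poly f (x + d) = poly f x + d * (poly (pderiv f) x + r * d)"
proof -
  obtain H K r where "H \<in> padic_ints" "K \<in> padic_ints" "r \<in> padic_ints"
    "poly f (x + d) = poly f x + poly (pderiv f) x * d + H * d ^ 2 + K * d ^ 3 + r * d ^ 4"
    using taylor_padic_int[OF assms(1,2)] assms(3) by metis
  moreover from this have "H + K * d + r * d ^ 2 \<in> padic_ints"
    using assms(3) by auto
  ultimately show ?thesis
    by (intro that[of "H + K * d + r * d ^ 2"]) (simp_all add: algebra_simps eval_nat_numeral)
qed

section \<open>The iteration\<close>

text \<open>
  With \<open>t = F / G\<^sup>2\<close>, \<open>H = f''(x) / 2\<close>, \<open>K = f'''(x) / 6\<close> and \<open>e = H - t G K\<close>, the step is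
  \<open>\<delta> = - t G (1 - t e) / (1 - 2 t e)\<close>. The third-order Taylor polynomial at \<open>\<delta>\<close> is then \<open>t\<^sup>4 G\<^sup>2\<close>
  times an integral expression over \<open>(1 - 2 t e)\<^sup>3\<close>.
\<close>

lemma taylor_step_identity:
  fixes t G H K :: "'a::field"
  defines "e \<equiv> H - t * G * K"
  defines "m \<equiv> 1 - 2 * t * e"
  assumes "m \<noteq> 0"
  defines "d \<equiv> - (t * G * (1 - t * e) / m)"
  shows "t * G ^ 2 + G * d + H * d ^ 2 + K * d ^ 3 =
    t ^ 4 * G ^ 2 * ((- e * G * K + e ^ 3 + 2 * t * e ^ 2 * G * K - 2 * t * e ^ 3 * H
      + t ^ 2 * e ^ 3 * G * K) / m ^ 3)"
proof -
  define q where "q = 1 - t * e"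
  have d: "m * d = - (t * G * q)"
    using \<open>m \<noteq> 0\<close> by (simp add: d_def q_def)
  \<comment> \<open>After multiplication by \<open>m ^ 3\<close>, \<open>d\<close> occurs only
    within \<open>m * d\<close>, which has no denominator. What remains is a polynomial
    identity.\<close>
  have "m ^ 3 * (t * G ^ 2 + G * d + H * d ^ 2 + K * d ^ 3) =
      m ^ 3 * t * G ^ 2 + m ^ 2 * G * (m * d) + m * H * (m * d) ^ 2 + K * (m * d) ^ 3"
    by Groebner_Basis.algebra
  also have "\<dots> = t ^ 4 * G ^ 2 * (- e * G * K + e ^ 3 + 2 * t * e ^ 2 * G * K - 2 * t * e ^ 3 * H
      + t ^ 2 * e ^ 3 * G * K)"
    unfolding d unfolding q_def m_def e_def by Groebner_Basis.algebra
  finally show ?thesis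
    using \<open>m \<noteq> 0\<close> by (simp add: nonzero_eq_divide_eq mult.commute)
qed

text \<open>Substituting \<open>F = t * G ^ 2\<close> factors the denominator \<open>D\<close> and
  thereby reduces its nonvanishing to that of \<open>m\<close>.\<close>

lemma step_eq:
  fixes x F G H K :: "'a::field"
  defines "t \<equiv> F / G ^ 2"
  defines "e \<equiv> H - t * G * K"
  defines "m \<equiv> 1 - 2 * t * e"
  defines "D \<equiv> - 6 * G ^ 3 + 6 * F * G * (2 * H) - 2 * F ^ 2 * (6 * K)"
  assumes "(2::'a) \<noteq> 0" "(3::'a) \<noteq> 0" "G \<noteq> 0" "m \<noteq> 0"
  shows "D = - 6 * G ^ 3 * m"
    and "x - 1 / 2 * (F / G) + 3 * F * G ^ 2 / D = x - t * G * (1 - t * e) / m"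
proof -
  have F: "F = t * G ^ 2"
    using \<open>G \<noteq> 0\<close> by (simp add: t_def)
  show D: "D = - 6 * G ^ 3 * m"
    unfolding D_def F m_def e_def by Groebner_Basis.algebra
  have "(6::'a) \<noteq> 0"
    using assms(5,6) mult_eq_0_iff[of "2::'a" 3] by simp
  hence "3 * F * G ^ 2 / D = - (t * G / (2 * m))"
    unfolding D F using assms(5-8) by (simp add: field_simps eval_nat_numeral)
  moreover have "F / G = t * G"
    unfolding F using \<open>G \<noteq> 0\<close> by (simp add: power2_eq_square)
  \<comment> \<open>This holds because \<open>1 + m = 2 * (1 - t * e)\<close>.\<close>
  moreover have "t * G / 2 + t * G / (2 * m) = t * G * (1 - t * e) / m"
    using assms(5,8) by (simp add: divide_simps) (unfold m_def, Groebner_Basis.algebra)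
  ultimately show "x - 1 / 2 * (F / G) + 3 * F * G ^ 2 / D = x - t * G * (1 - t * e) / m"
    by (simp add: algebra_simps)
qed

text \<open>Since \<open>t\<close> has norm below 1, both \<open>1 - t * e\<close> and
  \<open>m\<close> have norm 1, so the displacement has the size of the Newton correction
  \<open>F / G\<close>. The conclusions give what is needed to apply the lemma again at
  \<open>y\<close>.\<close>

lemma padic_step:
  fixes f :: "'p::prime_card padic poly"
  assumes p: "CARD('p) > 3" and f: "\<forall>i. Polynomial.coeff f i \<in> padic_ints" and x: "x \<in> padic_ints"
  defines "F \<equiv> poly f x" and "G \<equiv> poly (pderiv f) x"
  defines "D \<equiv> - 6 * G ^ 3 + 6 * F * G * poly ((pderiv ^^ 2) f) x - 2 * F ^ 2 * poly ((pderiv ^^ 3) f) x"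
  defines "y \<equiv> x - 1 / 2 * (F / G) + 3 * F * G ^ 2 / D"
  assumes small: "padic_norm F < padic_norm G ^ 2"
  shows "G \<noteq> 0" "D \<noteq> 0" "y \<in> padic_ints"
    and "padic_norm (y - x) \<le> padic_norm F / padic_norm G"
    and "padic_norm (poly (pderiv f) y) = padic_norm G"
    and "padic_norm (poly f y) \<le> padic_norm F ^ 4 / padic_norm G ^ 6"
proof -
  show G: "G \<noteq> 0"
    using small padic_norm_nonneg[of F] by auto
  hence posG: "padic_norm G > 0" by (simp add: padic_norm_pos_iff)
  \<comment> \<open>Here \<open>CARD('p) > 3\<close> enters: 2 and 3 are units, so the numerical
    coefficients of the iteration do no harm.\<close>
  have [simp]: "padic_norm (2 :: 'p padic) = 1" "padic_norm (3 :: 'p padic) = 1"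
    using p by (auto intro: padic_norm_2 padic_norm_3)
  hence nz: "(2 :: 'p padic) \<noteq> 0" "(3 :: 'p padic) \<noteq> 0"
    by (metis padic_norm_0 zero_neq_one)+
  have G_int: "G \<in> padic_ints"
    unfolding G_def by (intro poly_padic_int coeff_pderiv_padic_int f x)

  obtain H K where HK: "H \<in> padic_ints" "K \<in> padic_ints"
      "poly ((pderiv ^^ 2) f) x = 2 * H" "poly ((pderiv ^^ 3) f) x = 6 * K"
    and taylor: "\<And>d. d \<in> padic_ints \<Longrightarrow>
      \<exists>r\<in>padic_ints. poly f (x + d) = F + G * d + H * d ^ 2 + K * d ^ 3 + r * d ^ 4"
    unfolding F_def G_def using taylor_padic_int[OF f x] by metis
  define t where "t = F / G ^ 2"
  define e where "e = H - t * G * K"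
  define m where "m = 1 - 2 * t * e"
  define d where "d = - (t * G * (1 - t * e) / m)"
  have F: "F = t * G ^ 2" using G by (simp add: t_def)
  have t: "padic_norm t < 1"
    using small posG by (simp add: t_def padic_norm_divide padic_norm_power divide_less_eq)
  hence t_int: "t \<in> padic_ints" by (simp add: padic_ints_iff)
  have e_int: "e \<in> padic_ints"
    unfolding e_def using HK t_int G_int by blast
  have te: "padic_norm (t * e) < 1"
    using t e_int padic_norm_nonneg[of t] padic_norm_nonneg[of e]
    by (simp add: padic_norm_mult padic_ints_iff) (metis le_less_trans mult_left_le)
  have unit: "padic_norm (1 - u) = 1" if "padic_norm u < 1" for u :: "'p padic"
    using padic_norm_add_eq[of "- u" 1] that by (simp add: padic_norm_minus)
  have m: "padic_norm m = 1"
    unfolding m_def using te by (intro unit) (simp add: padic_norm_mult mult.assoc)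
  hence "m \<noteq> 0" by auto
  note step = step_eq[OF nz G \<open>m \<noteq> 0\<close>[unfolded m_def e_def t_def]]
  have D: "D = - 6 * G ^ 3 * m"
    unfolding D_def HK m_def e_def t_def by (rule step(1))
  have "y = x - t * G * (1 - t * e) / m"
    unfolding y_def D_def HK m_def e_def t_def by (rule step(2))
  hence y: "y = x + d" by (simp add: d_def)
  have "(6 :: 'p padic) = 2 * 3" by simp
  thus "D \<noteq> 0"
    unfolding D using nz G \<open>m \<noteq> 0\<close> by (metis mult_eq_0_iff neg_equal_0_iff_equal power_not_zero)

  have norm_d: "padic_norm d = padic_norm t * padic_norm G"
    by (simp add: d_def padic_norm_minus padic_norm_mult padic_norm_divide m unit[OF te])
  also have "\<dots> = padic_norm F / padic_norm G"
    using posG by (simp add: F padic_norm_mult padic_norm_power power2_eq_square)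
  finally show "padic_norm (y - x) \<le> padic_norm F / padic_norm G" by (simp add: y)
  \<comment> \<open>Moving by \<open>d\<close> changes the derivative by at most the norm of
    \<open>d\<close>, so this strict bound lets \<open>G\<close> dominate.\<close>
  have d_small: "padic_norm d < padic_norm G"
    unfolding norm_d using t posG by simp
  have d: "d \<in> padic_ints"
    using d_small G_int by (simp add: padic_ints_iff)
  thus "y \<in> padic_ints" unfolding y using x by blast
  obtain r where r: "r \<in> padic_ints"
    "poly (pderiv f) y = G + d * (poly (pderiv (pderiv f)) x + r * d)"
    using taylor1_padic_int[OF coeff_pderiv_padic_int[OF f] x d] unfolding y G_def by metis
  have "poly (pderiv (pderiv f)) x + r * d \<in> padic_ints"
    using r d by (intro padic_ints_add padic_ints_mult poly_padic_int coeff_pderiv_padic_int f x)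
  hence "padic_norm (d * (poly (pderiv (pderiv f)) x + r * d)) \<le> padic_norm d"
    by (simp add: padic_norm_mult padic_ints_iff mult_left_le padic_norm_nonneg)
  with d_small show "padic_norm (poly (pderiv f) y) = padic_norm G"
    unfolding r by (intro padic_norm_add_eq) simp

  obtain r where r: "r \<in> padic_ints" "poly f y = F + G * d + H * d ^ 2 + K * d ^ 3 + r * d ^ 4"
    using taylor[OF d] unfolding y by blast
  define c where "c = - e * G * K + e ^ 3 + 2 * t * e ^ 2 * G * K - 2 * t * e ^ 3 * H
      + t ^ 2 * e ^ 3 * G * K"
  define q where "q = 1 - t * e"
  have "c \<in> padic_ints"
    unfolding c_def using t_int e_int G_int HK
    by (intro padic_ints_add padic_ints_diff padic_ints_mult padic_ints_minus padic_ints_power) auto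
  moreover have "q \<in> padic_ints"
    unfolding q_def using t_int e_int by auto
  moreover have "inverse m \<in> padic_ints"
    by (simp add: padic_ints_iff padic_norm_inverse m)
  \<comment> \<open>This is the integral cofactor of \<open>t ^ 4 * G ^ 2\<close> in
    \<open>poly f y\<close>: its first summand comes from the cubic Taylor polynomial, its second
    from \<open>r * d ^ 4\<close>, which even contains \<open>t ^ 4 * G ^ 4\<close>.\<close>
  ultimately have "c * inverse m ^ 3 + r * G ^ 2 * q ^ 4 * inverse m ^ 4 \<in> padic_ints"
    using r(1) G_int by (intro padic_ints_add padic_ints_mult padic_ints_power)
  moreover have "poly f y = t ^ 4 * G ^ 2 * (c * inverse m ^ 3 + r * G ^ 2 * q ^ 4 * inverse m ^ 4)"
  proof -
    have "F + G * d + H * d ^ 2 + K * d ^ 3 = t ^ 4 * G ^ 2 * (c / m ^ 3)"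
      unfolding F c_def d_def m_def e_def
      by (rule taylor_step_identity) (use \<open>m \<noteq> 0\<close> in \<open>simp add: m_def e_def\<close>)
    moreover have "d ^ 4 = t ^ 4 * G ^ 4 * q ^ 4 / m ^ 4"
      by (simp add: d_def power_mult_distrib power_divide flip: q_def)
    hence "r * d ^ 4 = t ^ 4 * G ^ 2 * (r * G ^ 2 * q ^ 4 / m ^ 4)"
      by (simp add: eval_nat_numeral mult_ac)
    ultimately show ?thesis
      unfolding r by (simp only: distrib_left divide_inverse power_inverse mult.assoc)
  qed
  ultimately have "padic_norm (poly f y) \<le> padic_norm t ^ 4 * padic_norm G ^ 2"
    by (simp add: padic_norm_mult padic_norm_power padic_ints_iff mult_left_le padic_norm_nonneg)
  also have "\<dots> = padic_norm F ^ 4 / padic_norm G ^ 6"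
    using posG by (simp add: F padic_norm_mult padic_norm_power field_simps)
  finally show "padic_norm (poly f y) \<le> padic_norm F ^ 4 / padic_norm G ^ 6" .
qed

section \<open>Simple roots and convergence of the iteration\<close>

lemma order_eq_1:
  fixes f :: "'a::idom poly"
  assumes root: "poly f a = 0" and simple: "poly (pderiv f) a \<noteq> 0"
  shows "Polynomial.order a f = 1"
proof -
  have "f \<noteq> 0" using simple by auto
  hence "Polynomial.order a f \<noteq> 0" using root by (simp add: order_root)
  moreover have "\<not> 2 \<le> Polynomial.order a f"
  proof
    assume "2 \<le> Polynomial.order a f"
    hence "[:- a, 1:] ^ 2 dvd f" by (simp add: order_divides)
    then obtain g where g: "f = [:- a, 1:] ^ 2 * g" by (rule dvdE)
    \<comment> \<open>By the product rule every term of the derivative keeps a factor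
      \<open>[:- a, 1:]\<close>.\<close>
    have "poly (pderiv f) a = 0"
      unfolding g power2_eq_square by (simp add: pderiv_mult del: mult_pCons_left mult_pCons_right)
    with simple show False by simp
  qed
  ultimately show ?thesis by linarith
qed

text \<open>The formula of the iteration no longer matters here: bounds on one step, with a constant
  norm \<open>s\<close> of the derivative, suffice.\<close>

lemma padic_order_4:
  fixes f :: "'p::prime_card padic poly" and X :: "nat \<Rightarrow> 'p padic"
  assumes f: "\<forall>i. Polynomial.coeff f i \<in> padic_ints"
    and s: "0 < s" "s \<le> 1"
    and ints: "\<And>n. X n \<in> padic_ints"
    and deriv: "\<And>n. padic_norm (poly (pderiv f) (X n)) = s"
    and init: "padic_norm (poly f (X 0)) < s ^ 2"
    and step: "\<And>n. padic_norm (X (Suc n) - X n) \<le> padic_norm (poly f (X n)) / s"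
    and quartic: "\<And>n. padic_norm (poly f (X (Suc n))) \<le> padic_norm (poly f (X n)) ^ 4 / s ^ 6"
  shows "\<exists>\<gamma>\<in>padic_ints. poly f \<gamma> = 0 \<and> Polynomial.order \<gamma> f = 1 \<and> converges_with_order X \<gamma> 4"
proof -
  define F where "F n = padic_norm (poly f (X n))" for n
  define \<rho> where "\<rho> = F 0 / s ^ 2"
  have nonneg: "F n \<ge> 0" for n by (simp add: F_def padic_norm_nonneg)
  have \<rho>: "0 \<le> \<rho>" "\<rho> < 1"
    using init s nonneg[of 0] by (simp_all add: \<rho>_def F_def)
  \<comment> \<open>The quartic bound equals \<open>(F n / s ^ 2) ^ 3 * F n\<close>. Estimating the
    cube by \<rho> needs \<open>F n \<le> F 0\<close>, which is therefore carried along in the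
    induction.\<close>
  have contract: "F (Suc n) \<le> \<rho> * F n \<and> F n \<le> F 0" for n
  proof (induction n)
    have *: "F (Suc n) \<le> \<rho> * F n" if "F n \<le> F 0" for n
    proof -
      have "F (Suc n) \<le> (F n / s ^ 2) ^ 3 * F n"
        using quartic[of n] s by (simp add: F_def field_simps eval_nat_numeral)
      also have "\<dots> \<le> \<rho> ^ 3 * F n"
        using that s nonneg[of n]
        by (intro mult_right_mono power_mono) (auto simp: \<rho>_def divide_right_mono)
      also have "\<dots> \<le> \<rho> * F n"
        using \<rho> nonneg[of n] power_decreasing[of 1 3 \<rho>] by (intro mult_right_mono) auto
      finally show ?thesis .
    qed
    {
      case 0
      show ?case using *[of 0] by simp
    next
      case (Suc n)
      have "F (Suc n) \<le> F 0"
        using Suc \<rho> nonneg[of n] mult_left_le_one_le[of "F n" \<rho>] by linarith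
      thus ?case using * by blast
    }
  qed
  have antimono: "F (Suc n) \<le> F n" for n
    using contract[of n] \<rho> nonneg[of n] mult_left_le_one_le[of "F n" \<rho>] by linarith
  have "F n \<le> \<rho> ^ n * F 0" for n
  proof (induction n)
    case (Suc n)
    have "F (Suc n) \<le> \<rho> * F n" using contract by blast
    also have "\<dots> \<le> \<rho> * (\<rho> ^ n * F 0)" using Suc \<rho> by (intro mult_left_mono)
    finally show ?case by (simp add: mult.assoc)
  qed simp
  moreover have "(\<lambda>n. \<rho> ^ n * F 0) \<longlonglongrightarrow> 0"
    using \<rho> by (intro tendsto_mult_left_zero LIMSEQ_power_zero) simp
  ultimately have F_0: "F \<longlonglongrightarrow> 0"
    using nonneg by (intro tendsto_sandwich[of "\<lambda>_. 0" F sequentially "\<lambda>n. \<rho> ^ n * F 0"]) auto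

  \<comment> \<open>In an ultrametric the distance is bounded by the largest single step, not by the
    sum of the steps. As \<open>F\<close> decreases, that is at most \<open>F n / s\<close>.\<close>
  have dist_le: "dist (X (n + k)) (X n) \<le> F n / s" for n k
  proof (induction k)
    case 0
    show ?case using nonneg s by simp
  next
    case (Suc k)
    have "F (n + k) \<le> F n"
      using lift_Suc_antimono_le[of F n "n + k"] antimono by simp
    hence "padic_norm (X (Suc (n + k)) - X (n + k)) \<le> F n / s"
      using step[of "n + k"] s divide_right_mono[of "F (n + k)" "F n" s] by (simp add: F_def)
    thus ?case
      using Suc padic_norm_ultrametric[of "X (Suc (n + k)) - X (n + k)" "X (n + k) - X n"]
      by (simp add: dist_padic_def)
  qed
  have "Cauchy X"
    unfolding Cauchy_altdef2
  proof (intro allI impI)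
    fix e :: real assume "e > 0"
    hence "e * s > 0" using s by simp
    then obtain N where "F N < e * s"
      using metric_LIMSEQ_D[OF F_0] nonneg by fastforce
    hence "F N / s < e" using s by (simp add: divide_less_eq)
    hence "dist (X n) (X N) < e" if "n \<ge> N" for n
      using dist_le[of N "n - N"] that by simp
    thus "\<exists>N. \<forall>n\<ge>N. dist (X n) (X N) < e" by blast
  qed
  then obtain \<gamma> where lim: "X \<longlonglongrightarrow> \<gamma>"
    using Cauchy_convergent convergent_def by blast
  have d_le: "padic_norm (\<gamma> - X n) \<le> F n / s" for n
  proof -
    have "(\<lambda>m. dist (X m) (X n)) \<longlonglongrightarrow> dist \<gamma> (X n)"
      by (intro tendsto_intros lim)
    moreover have "dist (X m) (X n) \<le> F n / s" if "m \<ge> n" for m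
      using dist_le[of n "m - n"] that by simp
    ultimately show ?thesis
      unfolding dist_padic_def[symmetric] by (blast intro: LIMSEQ_le_const2)
  qed
  have d_small: "padic_norm (\<gamma> - X n) < s" for n
  proof -
    have "F n / s < s"
      using contract[of n] init s by (simp add: F_def divide_less_eq power2_eq_square)
    with d_le[of n] show ?thesis by simp
  qed
  have d_int: "\<gamma> - X n \<in> padic_ints" for n
    using d_small[of n] s by (simp add: padic_ints_iff)
  have \<gamma>: "\<gamma> \<in> padic_ints"
    using padic_ints_add[OF d_int[of 0] ints[of 0]] by simp

  have deriv_\<gamma>: "padic_norm (poly (pderiv f) \<gamma>) = s"
  proof -
    obtain r where r: "r \<in> padic_ints" "poly (pderiv f) (X 0 + (\<gamma> - X 0)) =
        poly (pderiv f) (X 0) + (\<gamma> - X 0) * (poly (pderiv (pderiv f)) (X 0) + r * (\<gamma> - X 0))"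
      by (rule taylor1_padic_int[OF coeff_pderiv_padic_int[OF f] ints d_int])
    have "poly (pderiv (pderiv f)) (X 0) + r * (\<gamma> - X 0) \<in> padic_ints"
      by (intro padic_ints_add padic_ints_mult poly_padic_int coeff_pderiv_padic_int f ints r d_int)
    hence "padic_norm ((\<gamma> - X 0) * (poly (pderiv (pderiv f)) (X 0) + r * (\<gamma> - X 0)))
        \<le> padic_norm (\<gamma> - X 0)"
      by (simp add: padic_norm_mult padic_ints_iff mult_left_le padic_norm_nonneg)
    with d_small[of 0] have "padic_norm ((\<gamma> - X 0) * (poly (pderiv (pderiv f)) (X 0) + r * (\<gamma> - X 0)))
        < padic_norm (poly (pderiv f) (X 0))"
      by (simp add: deriv)
    from padic_norm_add_eq[OF this] show ?thesis
      using r(2) deriv[of 0] by simp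
  qed

  \<comment> \<open>The expansion is centred at \<gamma>. Since \<open>X n\<close> is closer to
    \<gamma> than \<open>s\<close>, the derivative at \<gamma> dominates the cofactor
    \<open>u\<close>. This serves first to show that \<gamma> is a root and then to measure the
    distance to it.\<close>
  have taylor: "\<exists>u. padic_norm u = s \<and> poly f (X n) = poly f \<gamma> + (X n - \<gamma>) * u" for n
  proof -
    have d: "X n - \<gamma> \<in> padic_ints" using padic_ints_minus[OF d_int[of n]] by simp
    have "padic_norm (X n - \<gamma>) < s"
      using d_small[of n] padic_norm_minus[of "\<gamma> - X n"] by simp
    obtain r where r: "r \<in> padic_ints"
      "poly f (\<gamma> + (X n - \<gamma>)) = poly f \<gamma> + (X n - \<gamma>) * (poly (pderiv f) \<gamma> + r * (X n - \<gamma>))"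
      by (rule taylor1_padic_int[OF f \<gamma> d])
    have "padic_norm (r * (X n - \<gamma>)) \<le> padic_norm (X n - \<gamma>)"
      using r by (simp add: padic_norm_mult padic_ints_iff mult_left_le_one_le padic_norm_nonneg)
    hence "padic_norm (poly (pderiv f) \<gamma> + r * (X n - \<gamma>)) = s"
      using \<open>padic_norm (X n - \<gamma>) < s\<close> deriv_\<gamma> by (simp add: padic_norm_add_eq)
    with r show ?thesis by auto
  qed

  have root: "poly f \<gamma> = 0"
  proof -
    \<comment> \<open>Both \<open>poly f (X n)\<close> and its difference from the value at \<gamma>
      are bounded by \<open>F n\<close>, which tends to 0.\<close>
    have "padic_norm (poly f \<gamma>) \<le> F n" for n
    proof -
      obtain u where u: "padic_norm u = s" "poly f (X n) = poly f \<gamma> + (X n - \<gamma>) * u"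
        using taylor by blast
      have "padic_norm ((X n - \<gamma>) * u) \<le> F n"
        using d_le[of n] s padic_norm_minus[of "\<gamma> - X n"]
        by (simp add: padic_norm_mult u le_divide_eq)
      moreover have "poly f \<gamma> = poly f (X n) - (X n - \<gamma>) * u" using u by simp
      ultimately show ?thesis
        using padic_norm_diff_ultrametric[of "poly f (X n)" "(X n - \<gamma>) * u"] by (simp add: F_def)
    qed
    hence "padic_norm (poly f \<gamma>) \<le> 0"
      by (intro LIMSEQ_le_const[OF F_0]) auto
    thus ?thesis
      using padic_norm_nonneg[of "poly f \<gamma>"] padic_norm_eq_0_iff by (metis order_antisym)
  qed

  have dist_eq: "dist (X n) \<gamma> = F n / s" for n
    using taylor[of n] s by (auto simp: root F_def dist_padic_def padic_norm_mult)
  have rate: "dist (X (Suc n)) \<gamma> \<le> dist (X n) \<gamma> ^ 4 / s ^ 3" for n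
  proof -
    have "F (Suc n) / s \<le> (F n ^ 4 / s ^ 6) / s"
      using quartic[of n] s by (intro divide_right_mono) (simp_all add: F_def)
    also have "\<dots> = (F n / s) ^ 4 / s ^ 3"
      using s by (simp add: field_simps eval_nat_numeral)
    finally show ?thesis by (simp add: dist_eq)
  qed
  \<comment> \<open>If \<open>X n = \<gamma>\<close>, the quotient is 0 by the convention for
    division by zero. That the sequence then stays at \<gamma> follows separately from
    \<open>rate\<close>.\<close>
  have "norm (dist (X (Suc n)) \<gamma> / dist (X n) \<gamma> ^ 4) \<le> 1 / s ^ 3" for n
    using rate[of n] s by (cases "X n = \<gamma>") (simp_all add: divide_simps mult.commute)
  hence "Bseq (\<lambda>n. dist (X (Suc n)) \<gamma> / dist (X n) \<gamma> ^ 4)"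
    by (rule BseqI')
  moreover have "X n = \<gamma> \<longrightarrow> X (Suc n) = \<gamma>" for n
    using rate[of n] by auto
  ultimately have "converges_with_order X \<gamma> 4"
    using lim by (simp add: converges_with_order_def)
  moreover have "Polynomial.order \<gamma> f = 1"
    using deriv_\<gamma> s padic_norm_0 by (intro order_eq_1 root) auto
  ultimately show ?thesis using \<gamma> root by blast
qed

text \<open>As division in HOL is total, the conclusion also asserts that no denominator of the
  iteration vanishes. The shift \<open>x (n + 1)\<close> starts the sequence at the given
  \<open>x 1\<close>.\<close>

theorem theorem3p1:
  fixes f :: "'p::prime_card padic poly" and x :: "nat \<Rightarrow> 'p padic"
  assumes "CARD('p) > 3"
    and "\<forall>i. Polynomial.coeff f i \<in> padic_ints"
    and "lead_coeff f \<in> padic_int_units"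
    and "x 1 \<in> padic_ints"
    and "padic_norm (poly f (x 1)) < padic_norm (poly (pderiv f) (x 1)) ^ 2"
    and "\<forall>n\<ge>1. x (n + 1) = x n - 1 / 2 * (poly f (x n) / poly (pderiv f) (x n))
           + 3 * poly f (x n) * poly (pderiv f) (x n) ^ 2
             / (- 6 * poly (pderiv f) (x n) ^ 3
                + 6 * poly f (x n) * poly (pderiv f) (x n) * poly ((pderiv ^^ 2) f) (x n)
                - 2 * poly f (x n) ^ 2 * poly ((pderiv ^^ 3) f) (x n))"
  shows "(\<forall>n\<ge>1. poly (pderiv f) (x n) \<noteq> 0 \<and>
            - 6 * poly (pderiv f) (x n) ^ 3
            + 6 * poly f (x n) * poly (pderiv f) (x n) * poly ((pderiv ^^ 2) f) (x n)
            - 2 * poly f (x n) ^ 2 * poly ((pderiv ^^ 3) f) (x n) \<noteq> 0) \<and>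
         (\<exists>\<gamma>\<in>padic_ints. poly f \<gamma> = 0 \<and> Polynomial.order \<gamma> f = 1 \<and>
            converges_with_order (\<lambda>n. x (n + 1)) \<gamma> 4)"
proof -
  define s where "s = padic_norm (poly (pderiv f) (x 1))"
  note step = padic_step[OF assms(1,2)]
  have s: "s > 0"
    using step(1)[OF assms(4,5)] by (simp add: s_def padic_norm_pos_iff)
  have "poly (pderiv f) (x 1) \<in> padic_ints"
    by (intro poly_padic_int coeff_pderiv_padic_int assms)
  hence "s \<le> 1" by (simp add: s_def padic_ints_iff)
  \<comment> \<open>The derivative keeps the norm \<open>s\<close>, so the initial inequality can be
    compared with the same \<open>s ^ 2\<close> at every index. It is reproduced because
    \<open>(s ^ 2) ^ 4 / s ^ 6 = s ^ 2\<close>.\<close>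
  have inv: "x n \<in> padic_ints \<and> padic_norm (poly (pderiv f) (x n)) = s \<and> padic_norm (poly f (x n)) < s ^ 2"
    if "n \<ge> 1" for n
    using that
  proof (induction n rule: dec_induct)
    case base
    show ?case using assms(4,5) by (simp add: s_def)
  next
    case (step n)
    let ?F = "padic_norm (poly f (x n))"
    have n: "x n \<in> padic_ints" "?F < padic_norm (poly (pderiv f) (x n)) ^ 2"
      and s_n: "padic_norm (poly (pderiv f) (x n)) = s"
      using step.IH by auto
    note next_x = assms(6)[rule_format, OF step.hyps(1), unfolded Suc_eq_plus1[symmetric]]
    have "padic_norm (poly f (x (Suc n))) \<le> ?F ^ 4 / s ^ 6"
      using padic_step(6)[OF assms(1,2) n] unfolding next_x s_n .
    also have "\<dots> < (s ^ 2) ^ 4 / s ^ 6"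
      using step.IH s by (intro divide_strict_right_mono power_strict_mono) (auto simp: padic_norm_nonneg)
    also have "\<dots> = s ^ 2"
      using s by (simp add: field_simps eval_nat_numeral)
    finally show ?case
      using padic_step(3,5)[OF assms(1,2) n] s_n unfolding next_x by simp
  qed
  have small: "padic_norm (poly f (x n)) < padic_norm (poly (pderiv f) (x n)) ^ 2" if "n \<ge> 1" for n
    using inv[OF that] by simp
  have "\<exists>\<gamma>\<in>padic_ints. poly f \<gamma> = 0 \<and> Polynomial.order \<gamma> f = 1 \<and> converges_with_order (\<lambda>n. x (n + 1)) \<gamma> 4"
  proof (rule padic_order_4[OF assms(2) s \<open>s \<le> 1\<close>])
    fix n :: nat
    have n: "n + 1 \<ge> 1" by simp
    note next_x = assms(6)[rule_format, OF n]
    have s_n: "padic_norm (poly (pderiv f) (x (n + 1))) = s" using inv[OF n] by blast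
    show "x (n + 1) \<in> padic_ints" "padic_norm (poly (pderiv f) (x (n + 1))) = s"
      using inv[OF n] by blast+
    show "padic_norm (poly f (x (0 + 1))) < s ^ 2" using inv[of 1] by simp
    have "x (n + 1) \<in> padic_ints" using inv[OF n] by blast
    note step = padic_step(4,6)[OF assms(1,2) this small[OF n], folded next_x, unfolded s_n]
    show "padic_norm (x (Suc n + 1) - x (n + 1)) \<le> padic_norm (poly f (x (n + 1))) / s"
      and "padic_norm (poly f (x (Suc n + 1))) \<le> padic_norm (poly f (x (n + 1))) ^ 4 / s ^ 6"
      using step by simp_all
  qed
  thus ?thesis
    using padic_step(1,2)[OF assms(1,2)] inv small by blast
qed

end
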